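(* Let $n\geq 1$ be an integer. Then $$\sum_{\sigma \in S_n} y^{\ell(\sigma)} q^{\mathrm{omaj}(\sigma)} x^{\mathrm{odes}(\sigma)} =[n]_y!\prod_{i=1}^{\lfloor n/2\rfloor}\frac{1+yxq^{i}}{1+y},$$ and $$\sum_{\sigma \in S_n} y^{\ell(\sigma)} q^{\mathrm{emaj}(\sigma)} x^{\mathrm{edes}(\sigma)}=[n]_y!\prod_{i=1}^{\lfloor (n-1)/2\rfloor}\frac{1+yxq^{i}}{1+y}.$$
   Context: $S_n$ is the group of bijections of $[n]=\{1,\dots,n\}$. For $\sigma\in S_n$: $\ell(\sigma)=|\{(i,j)\in[n]^2: i<j,\ \sigma(i)>\sigma(j)\}|$ is the number of inversions; $D(\sigma)=\{i\in[n-1]:\sigma(i)>\sigma(i+1)\}$; $D(\sigma)_o$ and $D(\sigma)_e$ are the sets of odd, respectively even, elements of $D(\sigma)$; $\mathrm{odes}(\sigma)=|D(\sigma)_o|$, $\mathrm{edes}(\sigma)=|D(\sigma)_e|$, $\mathrm{omaj}(\sigma)=\sum_{i\in D(\sigma)_o}\frac{i+1}{2}$, $\mathrm{emaj}(\sigma)=\sum_{i\in D(\sigma)_e}\frac{i}{2}$. Also $[i]_y=\sum_{j=0}^{i-1}y^j$ and $[n]_y!=\prod_{i=1}^n [i]_y$. Here $x,y,q$ are commuting indeterminates, and empty products equal $1$. *)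

theory Defs
  imports
    "HOL-Combinatorics.Permutations"
    "HOL-Computational_Algebra.Polynomial_Factorial"
begin

text \<open>
  An element of \<open>S\<^sub>n\<close> is a function \<open>nat \<Rightarrow> nat\<close> that is a bijection of \<open>{1..n}\<close> and the identity
  elsewhere, so that it is determined by its restriction to \<open>{1..n}\<close>.
\<close>

definition symgroup :: "nat \<Rightarrow> (nat \<Rightarrow> nat) set" where
  "symgroup n = {\<sigma>. \<sigma> permutes {1..n}}"

definition inversions :: "nat \<Rightarrow> (nat \<Rightarrow> nat) \<Rightarrow> nat" where
  "inversions n \<sigma> = card {(i, j) \<in> {1..n} \<times> {1..n}. i < j \<and> \<sigma> i > \<sigma> j}"

definition descents :: "nat \<Rightarrow> (nat \<Rightarrow> nat) \<Rightarrow> nat set" where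
  "descents n \<sigma> = {i \<in> {1..n - 1}. \<sigma> i > \<sigma> (i + 1)}"

definition odd_descents :: "nat \<Rightarrow> (nat \<Rightarrow> nat) \<Rightarrow> nat set" where
  "odd_descents n \<sigma> = {i \<in> descents n \<sigma>. odd i}"

definition even_descents :: "nat \<Rightarrow> (nat \<Rightarrow> nat) \<Rightarrow> nat set" where
  "even_descents n \<sigma> = {i \<in> descents n \<sigma>. even i}"

definition odes :: "nat \<Rightarrow> (nat \<Rightarrow> nat) \<Rightarrow> nat" where
  "odes n \<sigma> = card (odd_descents n \<sigma>)"

definition edes :: "nat \<Rightarrow> (nat \<Rightarrow> nat) \<Rightarrow> nat" where
  "edes n \<sigma> = card (even_descents n \<sigma>)"

text \<open>The divisions by 2 below are exact because of the parity of the summation index.\<close>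

definition omaj :: "nat \<Rightarrow> (nat \<Rightarrow> nat) \<Rightarrow> nat" where
  "omaj n \<sigma> = (\<Sum>i\<in>odd_descents n \<sigma>. (i + 1) div 2)"

definition emaj :: "nat \<Rightarrow> (nat \<Rightarrow> nat) \<Rightarrow> nat" where
  "emaj n \<sigma> = (\<Sum>i\<in>even_descents n \<sigma>. i div 2)"

definition q_number :: "'a::comm_semiring_1 \<Rightarrow> nat \<Rightarrow> 'a" where
  "q_number y i = (\<Sum>j<i. y ^ j)"

definition q_factorial :: "'a::comm_semiring_1 \<Rightarrow> nat \<Rightarrow> 'a" where
  "q_factorial y n = (\<Prod>i=1..n. q_number y i)"

text \<open>
  The identities live in the field of rational functions in three indeterminates, realised as the
  fraction field of the iterated polynomial ring \<open>\<int>[y][x][q]\<close>: \<open>var_y\<close> is the variable of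
  the innermost polynomial ring, \<open>var_x\<close> of the middle one and \<open>var_q\<close> of the outermost one.
  In particular \<open>1 + var_y\<close> is nonzero there, so the quotients are genuine.
\<close>

type_synonym ratfun = "int poly poly poly fract"

definition var_y :: ratfun where "var_y = to_fract [:[:[:0, 1:]:]:]"

definition var_x :: ratfun where "var_x = to_fract [:[:0, 1:]:]"

definition var_q :: ratfun where "var_q = to_fract [:0, 1:]"

end

theory Submission
  imports Defs
begin

text \<open>
  Multiplying \<open>\<sigma>\<close> on the right by the adjacent transposition of the positions \<open>i\<close> and \<open>i + 1\<close>
  pairs the permutations that ascend at \<open>i\<close> with those that descend at \<open>i\<close>, and it changes the
  number of inversions by exactly one (\<open>sum_descent_swap\<close>). Everything follows from this pairing.

  The odd positions are pairwise non-adjacent, and so are the even ones. The swap at \<open>i\<close> therefore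
  leaves the descents at all other positions of the same parity alone. Hence, if descents at \<open>i\<close>
  are given the weight \<open>z\<close>, each ascending permutation and its partner contribute together
  \<open>1 + y z\<close> times the term of the former instead of \<open>1 + y\<close> times, so that the
  generating function gets multiplied by \<open>(1 + y z) / (1 + y)\<close>. Doing this for
  one position after the other (\<open>sum_weighted_descents\<close>) turns the generating function of the
  inversions into that of the theorem, with \<open>z = x q\<^sup>k\<close> at the \<open>k\<close>-th position of the given parity.
  In elementary terms, this is the factorisation of a Coxeter group into a parabolic subgroup,
  here generated by commuting reflections, and its minimal coset representatives.

  The inversions alone have the generating function \<open>[n]\<^sub>y!\<close>. The same swaps
  prove this as well: they move the largest value from the last position to any other one, which
  costs one inversion for each step (\<open>sum_inversions\<close>).
\<close>

section \<open>Swapping two adjacent positions\<close>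

lemma finite_symgroup [simp]: "finite (symgroup n)"
  by (simp add: symgroup_def finite_permutations)

lemma symgroup_comp_adjacent:
  assumes "\<sigma> \<in> symgroup n" "1 \<le> i" "i < n"
  shows "\<sigma> \<circ> transpose i (i + 1) \<in> symgroup n"
  using assms unfolding symgroup_def
  by (auto intro!: permutes_compose permutes_swap_id)

lemma symgroup_adjacent_neq:
  assumes "\<sigma> \<in> symgroup n"
  shows "\<sigma> i \<noteq> \<sigma> (i + 1)"
  using assms permutes_inj[of \<sigma> "{1..n}"] by (simp add: symgroup_def inj_eq)

text \<open>
  The transposition keeps the order of every pair of positions other than \<open>(i, i + 1)\<close>. So it maps
  the old inversions bijectively to the new ones, except for \<open>(i, i + 1)\<close>, which is added.
\<close>

lemma inversions_comp_adjacent: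
  assumes "1 \<le> i" "i < n" and asc: "\<sigma> i < \<sigma> (i + 1)"
  shows "inversions n (\<sigma> \<circ> transpose i (i + 1)) = Suc (inversions n \<sigma>)"
proof -
  define s where "s = transpose i (i + 1)"
  define Inv where "Inv = (\<lambda>\<tau>::nat \<Rightarrow> nat. {(a, b) \<in> {1..n} \<times> {1..n}. a < b \<and> \<tau> a > \<tau> b})"
  have ss: "s (s a) = a" for a
    by (simp add: s_def)
  have range: "s a \<in> {1..n} \<longleftrightarrow> a \<in> {1..n}" for a
    using assms by (auto simp: s_def transpose_def)
  have mono: "s a < s b" if "a < b" "(a, b) \<noteq> (i, i + 1)" for a b
    using that by (auto simp: s_def transpose_def)
  have s_i: "s i = i + 1" "s (i + 1) = i"
    by (simp_all add: s_def)
  have eq: "Inv (\<sigma> \<circ> s) = insert (i, i + 1) (map_prod s s ` Inv \<sigma>)"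
  proof (intro equalityI subsetI)
    fix p assume p: "p \<in> Inv (\<sigma> \<circ> s)"
    obtain a b where ab: "p = (a, b)"
      by (cases p)
    show "p \<in> insert (i, i + 1) (map_prod s s ` Inv \<sigma>)"
    proof (cases "p = (i, i + 1)")
      case False
      then have "(s a, s b) \<in> Inv \<sigma>"
        using p ab range mono[of a b] by (auto simp: Inv_def)
      then have "map_prod s s (s a, s b) \<in> map_prod s s ` Inv \<sigma>"
        by (rule imageI)
      then show ?thesis
        using ab ss by simp
    qed simp
  next
    fix p assume "p \<in> insert (i, i + 1) (map_prod s s ` Inv \<sigma>)"
    then consider "p = (i, i + 1)" | a b where "p = (s a, s b)" "(a, b) \<in> Inv \<sigma>"
      by auto
    then show "p \<in> Inv (\<sigma> \<circ> s)"
    proof cases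
      case 1
      then show ?thesis
        using assms s_i by (simp add: Inv_def)
    next
      case 2
      then have "(a, b) \<noteq> (i, i + 1)"
        using asc by (auto simp: Inv_def)
      then show ?thesis
        using 2 range mono[of a b] ss by (auto simp: Inv_def)
    qed
  qed
  have fin: "finite (Inv \<sigma>)"
    by (rule finite_subset[of _ "{1..n} \<times> {1..n}"]) (auto simp: Inv_def)
  have "inj s"
    by (metis injI ss)
  then have "card (map_prod s s ` Inv \<sigma>) = card (Inv \<sigma>)"
    by (intro card_image inj_on_subset[OF map_prod_inj_on[of s UNIV s UNIV]]) auto
  moreover have "(i, i + 1) \<notin> map_prod s s ` Inv \<sigma>"
  proof
    assume "(i, i + 1) \<in> map_prod s s ` Inv \<sigma>"
    then obtain a b where "(a, b) \<in> Inv \<sigma>" "s a = i" "s b = i + 1"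
      by auto
    then have "a = i + 1" "b = i" "(a, b) \<in> Inv \<sigma>"
      using ss s_i by metis+
    then show False
      by (simp add: Inv_def)
  qed
  ultimately have "card (Inv (\<sigma> \<circ> s)) = Suc (card (Inv \<sigma>))"
    using fin eq by simp
  then show ?thesis
    by (simp add: inversions_def Inv_def s_def)
qed

lemma sum_descent_swap:
  fixes y :: "'a::comm_semiring_1" and f :: "(nat \<Rightarrow> nat) \<Rightarrow> 'a"
  assumes "1 \<le> i" "i < n"
  shows "(\<Sum>\<sigma> | \<sigma> \<in> symgroup n \<and> \<sigma> (i + 1) < \<sigma> i \<and> P \<sigma>. y ^ inversions n \<sigma> * f \<sigma>)
    = y * (\<Sum>\<sigma> | \<sigma> \<in> symgroup n \<and> \<sigma> i < \<sigma> (i + 1) \<and> P (\<sigma> \<circ> transpose i (i + 1)).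
             y ^ inversions n \<sigma> * f (\<sigma> \<circ> transpose i (i + 1)))"
proof -
  let ?swap = "\<lambda>\<sigma>::nat \<Rightarrow> nat. \<sigma> \<circ> transpose i (i + 1)"
  have invol: "?swap (?swap \<sigma>) = \<sigma>" for \<sigma>
    by (simp add: comp_assoc)
  have at: "?swap \<sigma> i = \<sigma> (i + 1)" "?swap \<sigma> (i + 1) = \<sigma> i" for \<sigma>
    by simp_all
  note closed = symgroup_comp_adjacent[OF _ assms]
  have "(\<Sum>\<sigma> | \<sigma> \<in> symgroup n \<and> \<sigma> i < \<sigma> (i + 1) \<and> P (?swap \<sigma>).
             y * (y ^ inversions n \<sigma> * f (?swap \<sigma>)))
      = (\<Sum>\<sigma> | \<sigma> \<in> symgroup n \<and> \<sigma> (i + 1) < \<sigma> i \<and> P \<sigma>. y ^ inversions n \<sigma> * f \<sigma>)"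
  proof (rule sum.reindex_bij_witness[where i = ?swap and j = ?swap])
    fix \<sigma> assume "\<sigma> \<in> {\<sigma>. \<sigma> \<in> symgroup n \<and> \<sigma> i < \<sigma> (i + 1) \<and> P (?swap \<sigma>)}"
    then have \<sigma>: "\<sigma> \<in> symgroup n" "\<sigma> i < \<sigma> (i + 1)" "P (?swap \<sigma>)"
      by auto
    show "?swap \<sigma> \<in> {\<sigma>. \<sigma> \<in> symgroup n \<and> \<sigma> (i + 1) < \<sigma> i \<and> P \<sigma>}"
      using \<sigma> closed[OF \<sigma>(1)] by simp
    show "y ^ inversions n (?swap \<sigma>) * f (?swap \<sigma>) = y * (y ^ inversions n \<sigma> * f (?swap \<sigma>))"
      by (simp only: inversions_comp_adjacent[OF assms \<sigma>(2)] power_Suc mult.assoc)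
  next
    fix \<sigma> assume "\<sigma> \<in> {\<sigma>. \<sigma> \<in> symgroup n \<and> \<sigma> (i + 1) < \<sigma> i \<and> P \<sigma>}"
    then show "?swap \<sigma> \<in> {\<sigma>. \<sigma> \<in> symgroup n \<and> \<sigma> i < \<sigma> (i + 1) \<and> P (?swap \<sigma>)}"
      using closed[of \<sigma>] at[of \<sigma>] invol[of \<sigma>] by simp
  qed (simp_all only: invol)
  then show ?thesis
    by (simp only: sum_distrib_left)
qed

section \<open>The generating function of the inversions\<close>

text \<open>
  A permutation with its largest value \<open>n\<close> at position \<open>k + 1\<close> ascends at \<open>k\<close>, and the swap brings
  \<open>n\<close> to position \<open>k\<close>. Thus each step of the value \<open>n\<close> to the left contributes one factor \<open>y\<close>.
\<close>

lemma sum_inversions_largest_at: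
  fixes y :: "'a::comm_semiring_1"
  assumes "j < n"
  shows "(\<Sum>\<sigma> | \<sigma> \<in> symgroup n \<and> \<sigma> (n - j) = n. y ^ inversions n \<sigma>)
       = y ^ j * (\<Sum>\<sigma> | \<sigma> \<in> symgroup n \<and> \<sigma> n = n. y ^ inversions n \<sigma>)"
  using assms
proof (induction j)
  case (Suc j)
  define k where "k = n - Suc j"
  have k: "1 \<le> k" "k < n" "k + 1 = n - j"
    using Suc.prems by (auto simp: k_def)
  have le: "\<sigma> a \<le> n" if "\<sigma> \<in> symgroup n" "1 \<le> a" "a \<le> n" for \<sigma> a
    using that permutes_in_image[of \<sigma> "{1..n}" a] by (simp add: symgroup_def)
  have lt: "\<sigma> a < \<sigma> b" if "\<sigma> \<in> symgroup n" "1 \<le> a" "a \<le> n" "a \<noteq> b" "\<sigma> b = n" for \<sigma> a b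
    using that le[of \<sigma> a] permutes_inj[of \<sigma> "{1..n}"]
    by (metis (mono_tags) injD le_neq_implies_less mem_Collect_eq symgroup_def)
  have desc: "{\<sigma>. \<sigma> \<in> symgroup n \<and> \<sigma> k = n}
      = {\<sigma>. \<sigma> \<in> symgroup n \<and> \<sigma> (k + 1) < \<sigma> k \<and> \<sigma> k = n}"
    using lt[of _ "k + 1" k] k by auto
  have asc: "{\<sigma>. \<sigma> \<in> symgroup n \<and> \<sigma> k < \<sigma> (k + 1) \<and> (\<sigma> \<circ> transpose k (k + 1)) k = n}
      = {\<sigma>. \<sigma> \<in> symgroup n \<and> \<sigma> (n - j) = n}"
    using lt[of _ k "k + 1"] k by (auto simp flip: k(3))
  show ?case
    using sum_descent_swap[OF k(1,2), where P = "\<lambda>\<sigma>. \<sigma> k = n" and f = "\<lambda>_. 1" and y = y]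
      Suc.IH Suc.prems
    by (simp only: desc[symmetric] asc mult_1_right k_def[symmetric])
      (simp add: mult.assoc)
qed simp

lemma symgroup_fix_last: "{\<sigma>. \<sigma> \<in> symgroup (Suc n) \<and> \<sigma> (Suc n) = Suc n} = symgroup n"
proof -
  have "\<sigma> permutes {1..n}" if "\<sigma> permutes {1..Suc n}" "\<sigma> (Suc n) = Suc n" for \<sigma>
    using permutes_superset[OF that(1), of "{1..n}"] that(2)
    by (auto simp: le_Suc_eq)
  moreover have "\<sigma> permutes {1..Suc n}" "\<sigma> (Suc n) = Suc n" if "\<sigma> permutes {1..n}" for \<sigma>
    using permutes_subset[OF that, of "{1..Suc n}"] permutes_not_in[OF that, of "Suc n"] by auto
  ultimately show ?thesis
    by (auto simp: symgroup_def)
qed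

lemma inversions_Suc:
  assumes "\<sigma> \<in> symgroup n"
  shows "inversions (Suc n) \<sigma> = inversions n \<sigma>"
proof -
  have last: "\<sigma> (Suc n) = Suc n"
    using assms symgroup_fix_last by blast
  have le: "\<sigma> a \<le> n" if "1 \<le> a" "a \<le> n" for a
    using that assms permutes_in_image[of \<sigma> "{1..n}" a] by (simp add: symgroup_def)
  have "{(a, b) \<in> {1..Suc n} \<times> {1..Suc n}. a < b \<and> \<sigma> a > \<sigma> b}
      = {(a, b) \<in> {1..n} \<times> {1..n}. a < b \<and> \<sigma> a > \<sigma> b}"
    using last le by (fastforce simp: le_Suc_eq)
  then show ?thesis
    by (simp add: inversions_def)
qed

text \<open>
  Sorting the permutations of \<open>{1..n + 1}\<close> by the position of the value \<open>n + 1\<close> gives the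
  factor \<open>[n + 1]\<^sub>y\<close>. What remains are the permutations that fix \<open>n + 1\<close>.
\<close>

lemma sum_inversions:
  fixes y :: "'a::comm_semiring_1"
  shows "(\<Sum>\<sigma>\<in>symgroup n. y ^ inversions n \<sigma>) = q_factorial y n"
proof (induction n)
  case 0
  then show ?case
    by (simp add: symgroup_def inversions_def q_factorial_def)
next
  case (Suc n)
  define A where
    "A = (\<lambda>j. {\<sigma>. \<sigma> \<in> symgroup (Suc n) \<and> \<sigma> (Suc n - j) = Suc n})"
  have cover: "symgroup (Suc n) = (\<Union>j<Suc n. A j)"
  proof (intro equalityI subsetI)
    fix \<sigma> assume \<sigma>: "\<sigma> \<in> symgroup (Suc n)"
    then have "Suc n \<in> \<sigma> ` {1..Suc n}"
      using permutes_image[of \<sigma> "{1..Suc n}"] by (simp add: symgroup_def)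
    then obtain k where k: "1 \<le> k" "k \<le> Suc n" "\<sigma> k = Suc n"
      by auto
    then have "Suc n - (Suc n - k) = k" "Suc n - k < Suc n"
      by auto
    then have "\<sigma> \<in> A (Suc n - k)" "Suc n - k \<in> {..<Suc n}"
      using \<sigma> k by (auto simp: A_def)
    then show "\<sigma> \<in> (\<Union>j<Suc n. A j)"
      by blast
  qed (auto simp: A_def)
  have disjoint: "A j \<inter> A k = {}" if "j < Suc n" "k < Suc n" "j \<noteq> k" for j k
  proof (rule equals0I)
    fix \<sigma> assume "\<sigma> \<in> A j \<inter> A k"
    then have "\<sigma> \<in> symgroup (Suc n)" "\<sigma> (Suc n - j) = \<sigma> (Suc n - k)"
      by (auto simp: A_def)
    then have "Suc n - j = Suc n - k"
      by (metis injD mem_Collect_eq permutes_inj symgroup_def)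
    then show False
      using that by simp
  qed
  have fin: "finite (A j)" for j
    by (rule finite_subset[of _ "symgroup (Suc n)"]) (auto simp: A_def)
  have "(\<Sum>\<sigma>\<in>symgroup (Suc n). y ^ inversions (Suc n) \<sigma>)
      = (\<Sum>j<Suc n. \<Sum>\<sigma>\<in>A j. y ^ inversions (Suc n) \<sigma>)"
    using disjoint fin by (subst cover, intro sum.UNION_disjoint) auto
  also have "\<dots> = (\<Sum>j<Suc n. y ^ j * (\<Sum>\<sigma>\<in>symgroup n. y ^ inversions (Suc n) \<sigma>))"
    by (intro sum.cong) (simp_all only: A_def lessThan_iff sum_inversions_largest_at symgroup_fix_last)
  also have "\<dots> = q_number y (Suc n) * (\<Sum>\<sigma>\<in>symgroup n. y ^ inversions n \<sigma>)"
    by (simp add: inversions_Suc q_number_def sum_distrib_right[symmetric] del: sum.lessThan_Suc)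
  also have "\<dots> = q_factorial y (Suc n)"
    by (simp add: Suc q_factorial_def mult.commute)
  finally show ?case .
qed

section \<open>Weighting descents at non-adjacent positions\<close>

text \<open>
  The factor \<open>(1 + y z\<^sub>i) / (1 + y)\<close> of each position \<open>i\<close> is cleared of its denominator, so that the
  identity holds in any commutative semiring. In the induction step, the permutations that ascend
  at the new position \<open>i\<close> have the sum \<open>U\<close>, and their partners contribute \<open>y U\<close>
  without the weight at \<open>i\<close> and \<open>y z\<^sub>i U\<close> with it.
\<close>

lemma sum_weighted_descents:
  fixes y :: "'a::comm_semiring_1" and z :: "nat \<Rightarrow> 'a"
  assumes "finite I" "I \<subseteq> {1..<n}" and nonadjacent: "\<And>i. i \<in> I \<Longrightarrow> i + 1 \<notin> I"
  shows "(1 + y) ^ card I * (\<Sum>\<sigma>\<in>symgroup n.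
            y ^ inversions n \<sigma> * (\<Prod>i\<in>I. if \<sigma> (i + 1) < \<sigma> i then z i else 1))
       = q_factorial y n * (\<Prod>i\<in>I. 1 + y * z i)"
  using assms
proof (induction I rule: finite_induct)
  case empty
  then show ?case
    by (simp add: sum_inversions)
next
  case (insert i I)
  let ?s = "transpose i (i + 1)"
  define w where "w = (\<lambda>\<sigma>::nat \<Rightarrow> nat. \<Prod>j\<in>I. if \<sigma> (j + 1) < \<sigma> j then z j else 1)"
  define U where
    "U = (\<Sum>\<sigma> | \<sigma> \<in> symgroup n \<and> \<sigma> i < \<sigma> (i + 1). y ^ inversions n \<sigma> * w \<sigma>)"
  have i: "1 \<le> i" "i < n"
    using insert.prems(1) by auto
  have w_swap: "w (\<sigma> \<circ> ?s) = w \<sigma>" for \<sigma>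
    unfolding w_def
  proof (rule prod.cong)
    fix j assume j: "j \<in> I"
    then have "j \<noteq> i" "j \<noteq> i + 1" "j + 1 \<noteq> i"
      using insert.hyps(2) insert.prems(2)[of i] insert.prems(2)[of j] by auto
    then show "(if (\<sigma> \<circ> ?s) (j + 1) < (\<sigma> \<circ> ?s) j then z j else 1)
        = (if \<sigma> (j + 1) < \<sigma> j then z j else 1)"
      by (simp add: transpose_def)
  qed simp
  have split: "(\<Sum>\<sigma>\<in>symgroup n. g \<sigma>)
      = (\<Sum>\<sigma> | \<sigma> \<in> symgroup n \<and> \<sigma> i < \<sigma> (i + 1). g \<sigma>)
      + (\<Sum>\<sigma> | \<sigma> \<in> symgroup n \<and> \<sigma> (i + 1) < \<sigma> i. g \<sigma>)" for g :: "(nat \<Rightarrow> nat) \<Rightarrow> 'a"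
  proof -
    have "symgroup n = {\<sigma>. \<sigma> \<in> symgroup n \<and> \<sigma> i < \<sigma> (i + 1)}
        \<union> {\<sigma>. \<sigma> \<in> symgroup n \<and> \<sigma> (i + 1) < \<sigma> i}"
      using symgroup_adjacent_neq[of _ n i] by (auto simp: neq_iff)
    then show ?thesis
      by (metis (no_types, lifting) sum.union_disjoint finite_Un finite_symgroup
          disjoint_iff mem_Collect_eq less_asym)
  qed
  have desc: "(\<Sum>\<sigma> | \<sigma> \<in> symgroup n \<and> \<sigma> (i + 1) < \<sigma> i. y ^ inversions n \<sigma> * w \<sigma>) = y * U"
    using sum_descent_swap[OF i, where P = "\<lambda>_. True" and f = w and y = y]
    by (simp only: w_swap U_def simp_thms)
  have unweighted: "(\<Sum>\<sigma>\<in>symgroup n. y ^ inversions n \<sigma> * w \<sigma>) = (1 + y) * U"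
    unfolding split[of "\<lambda>\<sigma>. y ^ inversions n \<sigma> * w \<sigma>"] desc
    by (simp add: U_def algebra_simps)
  have "(\<Sum>\<sigma>\<in>symgroup n. y ^ inversions n \<sigma>
          * (\<Prod>j\<in>insert i I. if \<sigma> (j + 1) < \<sigma> j then z j else 1))
      = (\<Sum>\<sigma>\<in>symgroup n. (if \<sigma> (i + 1) < \<sigma> i then z i else 1) * (y ^ inversions n \<sigma> * w \<sigma>))"
    using insert.hyps by (simp add: w_def mult.left_commute)
  also have "\<dots> = U
      + (\<Sum>\<sigma> | \<sigma> \<in> symgroup n \<and> \<sigma> (i + 1) < \<sigma> i. z i * (y ^ inversions n \<sigma> * w \<sigma>))"
    unfolding U_def
    by (subst split) (intro arg_cong2[where f = "(+)"] sum.cong; auto)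
  also have "\<dots> = (1 + y * z i) * U"
    by (simp only: sum_distrib_left[symmetric] desc) (simp add: algebra_simps)
  finally have weighted: "(\<Sum>\<sigma>\<in>symgroup n. y ^ inversions n \<sigma>
      * (\<Prod>j\<in>insert i I. if \<sigma> (j + 1) < \<sigma> j then z j else 1)) = (1 + y * z i) * U" .
  have IH: "(1 + y) ^ card I * ((1 + y) * U) = q_factorial y n * (\<Prod>j\<in>I. 1 + y * z j)"
    unfolding unweighted[symmetric] w_def
  proof (rule insert.IH)
    show "I \<subseteq> {1..<n}"
      using insert.prems(1) by blast
    show "j + 1 \<notin> I" if "j \<in> I" for j
      using insert.prems(2)[of j] that by blast
  qed
  have "(1 + y) ^ card (insert i I) * ((1 + y * z i) * U)
      = (1 + y * z i) * ((1 + y) ^ card I * ((1 + y) * U))"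
    using insert.hyps by (simp add: ac_simps)
  also have "\<dots> = q_factorial y n * (\<Prod>j\<in>insert i I. 1 + y * z j)"
    unfolding IH using insert.hyps by (simp add: mult.left_commute)
  finally show ?case
    unfolding weighted .
qed

text \<open>
  The positions are \<open>p k\<close> for \<open>k = 1..m\<close>, and the distance of at least two between them
  keeps them non-adjacent. The distance is demanded from \<open>k = 1\<close> on only, because truncated
  subtraction puts the odd positions \<open>p k = 2 * k - 1\<close> at \<open>p 0 = 0\<close> and \<open>p 1 = 1\<close>.
\<close>

lemma sum_weighted_descents_indexed:
  fixes y :: "'a::field" and z :: "nat \<Rightarrow> 'a" and p :: "nat \<Rightarrow> nat"
  assumes y: "1 + y \<noteq> 0" and range: "p ` {1..m} \<subseteq> {1..<n}"
    and gap: "\<And>j k. 1 \<le> j \<Longrightarrow> j < k \<Longrightarrow> p j + 1 < p k"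
  shows "(\<Sum>\<sigma>\<in>symgroup n. y ^ inversions n \<sigma> *
            (\<Prod>i\<in>p ` {1..m}. if \<sigma> (i + 1) < \<sigma> i then z i else 1))
       = q_factorial y n * (\<Prod>k=1..m. (1 + y * z (p k)) / (1 + y))"
proof -
  have inj: "inj_on p {1..m}"
  proof (rule linorder_inj_onI')
    fix j k assume "j \<in> {1..m}" "j < k"
    then show "p j \<noteq> p k"
      using gap[of j k] by simp
  qed
  have apart: "p j + 1 \<noteq> p k" if "1 \<le> j" "1 \<le> k" for j k
    using that gap[of j k] gap[of k j] by (cases j k rule: linorder_cases) auto
  then have nonadjacent: "i + 1 \<notin> p ` {1..m}" if "i \<in> p ` {1..m}" for i
    using that by fastforce
  define S where "S = (\<Sum>\<sigma>\<in>symgroup n. y ^ inversions n \<sigma> *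
            (\<Prod>i\<in>p ` {1..m}. if \<sigma> (i + 1) < \<sigma> i then z i else 1))"
  have "(1 + y) ^ card (p ` {1..m}) * S = q_factorial y n * (\<Prod>i\<in>p ` {1..m}. 1 + y * z i)"
    unfolding S_def by (rule sum_weighted_descents[OF _ range nonadjacent]) simp_all
  then have "(1 + y) ^ m * S = q_factorial y n * (\<Prod>k=1..m. 1 + y * z (p k))"
    using inj by (simp add: card_image prod.reindex)
  then have "S = q_factorial y n * ((\<Prod>k=1..m. 1 + y * z (p k)) / (1 + y) ^ m)"
    using y by (simp add: eq_divide_eq mult.commute)
  also have "\<dots> = q_factorial y n * (\<Prod>k=1..m. (1 + y * z (p k)) / (1 + y))"
    by (simp add: prod_dividef)
  finally show ?thesis
    unfolding S_def .
qed

section \<open>Odd and even descents\<close>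

lemma prod_descents_eq:
  fixes q x :: "'a::comm_semiring_1"
  assumes "finite I"
  shows "q ^ (\<Sum>i | i \<in> I \<and> D i. h i) * x ^ card {i \<in> I. D i}
       = (\<Prod>i\<in>I. if D i then x * q ^ h i else 1)"
  using assms
  by (simp add: prod.inter_filter[symmetric] prod.distrib power_sum mult.commute)

lemma odd_positions:
  fixes n :: nat
  shows "{i \<in> {1..n - 1}. odd i} = (\<lambda>k. 2 * k - 1) ` {1..n div 2}"
proof (intro equalityI subsetI)
  fix i :: nat assume "i \<in> {i \<in> {1..n - 1}. odd i}"
  then have "i = 2 * ((i + 1) div 2) - 1" "(i + 1) div 2 \<in> {1..n div 2}"
    by (auto elim!: oddE)
  then show "i \<in> (\<lambda>k. 2 * k - 1) ` {1..n div 2}"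
    by blast
qed auto

lemma even_positions:
  fixes n :: nat
  shows "{i \<in> {1..n - 1}. even i} = (\<lambda>k. 2 * k) ` {1..(n - 1) div 2}"
proof (intro equalityI subsetI)
  fix i :: nat assume "i \<in> {i \<in> {1..n - 1}. even i}"
  then have "i = 2 * (i div 2)" "i div 2 \<in> {1..(n - 1) div 2}"
    by (auto elim!: evenE)
  then show "i \<in> (\<lambda>k. 2 * k) ` {1..(n - 1) div 2}"
    by blast
qed auto

lemma omaj_odes_weight:
  fixes q x :: "'a::comm_semiring_1"
  shows "q ^ omaj n \<sigma> * x ^ odes n \<sigma> = (\<Prod>i\<in>(\<lambda>k. 2 * k - 1) ` {1..n div 2}.
           if \<sigma> (i + 1) < \<sigma> i then x * q ^ ((i + 1) div 2) else 1)"
proof -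
  let ?I = "{i \<in> {1..n - 1}. odd i}"
  have "odd_descents n \<sigma> = {i \<in> ?I. \<sigma> (i + 1) < \<sigma> i}"
    by (auto simp: odd_descents_def descents_def)
  then show ?thesis
    using prod_descents_eq[of ?I q "\<lambda>i. (i + 1) div 2" "\<lambda>i. \<sigma> (i + 1) < \<sigma> i" x]
    unfolding omaj_def odes_def odd_positions[symmetric] by simp
qed

lemma emaj_edes_weight:
  fixes q x :: "'a::comm_semiring_1"
  shows "q ^ emaj n \<sigma> * x ^ edes n \<sigma> = (\<Prod>i\<in>(\<lambda>k. 2 * k) ` {1..(n - 1) div 2}.
           if \<sigma> (i + 1) < \<sigma> i then x * q ^ (i div 2) else 1)"
proof -
  let ?I = "{i \<in> {1..n - 1}. even i}"
  have "even_descents n \<sigma> = {i \<in> ?I. \<sigma> (i + 1) < \<sigma> i}"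
    by (auto simp: even_descents_def descents_def)
  then show ?thesis
    using prod_descents_eq[of ?I q "\<lambda>i. i div 2" "\<lambda>i. \<sigma> (i + 1) < \<sigma> i" x]
    unfolding emaj_def edes_def even_positions[symmetric] by simp
qed

lemma one_plus_var_y_neq_0: "1 + var_y \<noteq> 0"
proof -
  have "1 + var_y = to_fract (1 + [:[:[:0, 1:]:]:])"
    unfolding var_y_def by (simp only: to_fract_add to_fract_1)
  moreover have "1 + [:[:[:0, 1:]:]:] \<noteq> (0 :: int poly poly poly)"
    by (simp add: one_pCons)
  ultimately show ?thesis
    by (simp only: to_fract_eq_0_iff not_False_eq_True)
qed

theorem theorem3p1:
  fixes n :: nat
  assumes "n \<ge> 1"
  shows "(\<Sum>\<sigma>\<in>symgroup n. var_y ^ inversions n \<sigma> * var_q ^ omaj n \<sigma> * var_x ^ odes n \<sigma>) =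
           q_factorial var_y n * (\<Prod>i=1..n div 2. (1 + var_y * var_x * var_q ^ i) / (1 + var_y))
       \<and> (\<Sum>\<sigma>\<in>symgroup n. var_y ^ inversions n \<sigma> * var_q ^ emaj n \<sigma> * var_x ^ edes n \<sigma>) =
           q_factorial var_y n * (\<Prod>i=1..(n - 1) div 2. (1 + var_y * var_x * var_q ^ i) / (1 + var_y))"
proof
  have "(\<Sum>\<sigma>\<in>symgroup n. var_y ^ inversions n \<sigma> * (var_q ^ omaj n \<sigma> * var_x ^ odes n \<sigma>))
      = q_factorial var_y n *
        (\<Prod>k=1..n div 2. (1 + var_y * (var_x * var_q ^ ((2 * k - 1 + 1) div 2))) / (1 + var_y))"
    unfolding omaj_odes_weight
    by (rule sum_weighted_descents_indexed[OF one_plus_var_y_neq_0]) auto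
  also have "\<dots> = q_factorial var_y n *
      (\<Prod>i=1..n div 2. (1 + var_y * var_x * var_q ^ i) / (1 + var_y))"
    by (intro arg_cong2[where f = "(*)"] prod.cong) (auto simp: mult.assoc)
  finally show "(\<Sum>\<sigma>\<in>symgroup n. var_y ^ inversions n \<sigma> * var_q ^ omaj n \<sigma> * var_x ^ odes n \<sigma>) =
      q_factorial var_y n * (\<Prod>i=1..n div 2. (1 + var_y * var_x * var_q ^ i) / (1 + var_y))"
    by (simp only: mult.assoc)
next
  have "(\<Sum>\<sigma>\<in>symgroup n. var_y ^ inversions n \<sigma> * (var_q ^ emaj n \<sigma> * var_x ^ edes n \<sigma>))
      = q_factorial var_y n *
        (\<Prod>k=1..(n - 1) div 2. (1 + var_y * (var_x * var_q ^ (2 * k div 2))) / (1 + var_y))"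
    unfolding emaj_edes_weight
    by (rule sum_weighted_descents_indexed[OF one_plus_var_y_neq_0]) auto
  then show "(\<Sum>\<sigma>\<in>symgroup n. var_y ^ inversions n \<sigma> * var_q ^ emaj n \<sigma> * var_x ^ edes n \<sigma>) =
      q_factorial var_y n *
      (\<Prod>i=1..(n - 1) div 2. (1 + var_y * var_x * var_q ^ i) / (1 + var_y))"
    by (simp add: mult.assoc)
qed

end
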